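(* Consider the functions $f_d:\mathbb R^d\to\mathbb R$, $d\in\mathbb N$, given by $f_d(x)=\prod_{i=1}^d x_i$, and let $r\in[1,\infty)$. Then for all integers $d\ge2$ and all $\varepsilon\in(0,\min\{1/2,r^{-1}\}]$, there exists $\phi\in\mathcal N$ with $\mathcal R_{\mathrm{ReLU}}^\phi\in C(\mathbb R^d,\mathbb R)$ such that 1) $\sup_{x\in[-r,r]^d}|f_d(x)-\mathcal R_{\mathrm{ReLU}}^\phi(x)|\le\varepsilon$, 2) $\mathcal R_{\mathrm{ReLU}}^\phi$ is $8^{(d-1)/2}\,r^{d(d-1)}$-Lipschitz continuous on $\mathbb R^d$, 3) $\mathcal P(\phi)\le\tfrac13\,10^5\,\log_2(d)\,d^6\,\log_2(\varepsilon^{-1})$ if $r=1$, and 4) $\mathcal P(\phi)\le\tfrac25\,10^5\,\log_2(r)\,\log_2(d)\,d^8\,\log_2(\varepsilon^{-1})$ if $r\ge2$.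
   Context: $\mathbb N=\{1,2,\dots\}$; Lipschitz continuity is with respect to the Euclidean norm. A skeleton is $\phi=[(V_1,b_1),\dots,(V_D,b_D)]$ with $D\in\mathbb N$, $l_0,\dots,l_D\in\mathbb N$, $V_k\in\mathbb R^{l_k\times l_{k-1}}$, $b_k\in\mathbb R^{l_k}$. $\mathcal N$ is the set of all skeletons, and the number of parameters is $\mathcal P(\phi)=\sum_{k=1}^D l_k(l_{k-1}+1)$. With $\mathrm{ReLU}(x)=\max\{x,0\}$ applied componentwise, the ReLU-realization is $\mathcal R_{\mathrm{ReLU}}^\phi=A_D\circ\mathrm{ReLU}\circ A_{D-1}\circ\cdots\circ\mathrm{ReLU}\circ A_1\in C(\mathbb R^{l_0},\mathbb R^{l_D})$ with $A_k(x)=V_kx+b_k$. *)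

theory Defs
  imports Complex_Main "HOL-Library.Extended_Real" "HOL-Library.FuncSet" "HOL-Analysis.L2_Norm"
    "Jordan_Normal_Form.Matrix"
begin

text \<open>The space of real n-vectors is \<^term>\<open>carrier_vec n\<close>; components are indexed from 0.\<close>

definition euclid_norm :: "real vec \<Rightarrow> real" where
  "euclid_norm v = L2_set (vec_index v) {..<dim_vec v}"

definition continuous_maps :: "nat \<Rightarrow> nat \<Rightarrow> (real vec \<Rightarrow> real vec) set" where
  "continuous_maps m n = {f \<in> carrier_vec m \<rightarrow> carrier_vec n.
     \<forall>x\<in>carrier_vec m. \<forall>e>0. \<exists>\<delta>>0. \<forall>y\<in>carrier_vec m.
       euclid_norm (y - x) < \<delta> \<longrightarrow> euclid_norm (f y - f x) < e}"

definition lipschitz_map :: "nat \<Rightarrow> real \<Rightarrow> (real vec \<Rightarrow> real vec) \<Rightarrow> bool" where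
  "lipschitz_map m L f \<longleftrightarrow>
     (\<forall>x\<in>carrier_vec m. \<forall>y\<in>carrier_vec m. euclid_norm (f x - f y) \<le> L * euclid_norm (x - y))"

definition cube :: "nat \<Rightarrow> real \<Rightarrow> real vec set" where
  "cube d r = {x \<in> carrier_vec d. \<forall>i<d. vec_index x i \<in> {-r..r}}"

definition product_fun :: "nat \<Rightarrow> real vec \<Rightarrow> real" where
  "product_fun d x = (\<Prod>i<d. vec_index x i)"

type_synonym skeleton = "(real mat \<times> real vec) list"

text \<open>The layer \<open>(V\<^sub>k, b\<^sub>k)\<close>, counted from 1, is the list entry at position \<open>k - 1\<close>.\<close>

definition skeletons :: "skeleton set" where
  "skeletons = {\<phi>. \<exists>D l. 1 \<le> D \<and> length \<phi> = D \<and> (\<forall>k\<le>D. 1 \<le> l k) \<and>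
     (\<forall>k\<in>{1..D}. fst (\<phi> ! (k - 1)) \<in> carrier_mat (l k) (l (k - 1)) \<and>
                  snd (\<phi> ! (k - 1)) \<in> carrier_vec (l k))}"

text \<open>The input and output dimensions \<open>l\<^sub>0\<close> and \<open>l\<^sub>D\<close>. They are recorded separately because
  the type of a realization does not carry its domain.\<close>

definition in_dim :: "skeleton \<Rightarrow> nat" where
  "in_dim \<phi> = dim_col (fst (hd \<phi>))"

definition out_dim :: "skeleton \<Rightarrow> nat" where
  "out_dim \<phi> = dim_row (fst (last \<phi>))"

definition num_params :: "skeleton \<Rightarrow> nat" where
  "num_params \<phi> = (\<Sum>(V, b)\<leftarrow>\<phi>. dim_row V * (dim_col V + 1))"

definition relu :: "real \<Rightarrow> real" where
  "relu x = max x 0"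

definition affine :: "real mat \<Rightarrow> real vec \<Rightarrow> real vec \<Rightarrow> real vec" where
  "affine V b x = V *\<^sub>v x + b"

text \<open>No activation is applied after the last layer. The equation for the empty list, which is not
  a skeleton, only makes the function total.\<close>

fun relu_realization :: "skeleton \<Rightarrow> real vec \<Rightarrow> real vec" where
  "relu_realization [] x = x"
| "relu_realization [(V, b)] x = affine V b x"
| "relu_realization ((V, b) # L # \<phi>) x =
     relu_realization (L # \<phi>) (map_vec relu (affine V b x))"

end

theory Submission imports Defs begin

text \<open>After clipping and rescaling to \<open>[-1,1]\<close>, the factors are multiplied one at a time.
  The identity \<open>p x = 4 (h ((p - x + 2) / 4) - h ((p + x + 2) / 4))\<close> for \<open>h t = t (1 - t)\<close> reduces
  multiplication to \<open>h\<close>, and \<open>h t = (g t + h (g t)) / 4\<close> for the tent map \<open>g\<close> shows that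
  \<open>m\<close> ReLU layers of fixed width compute \<open>h\<close> up to \<open>4\<^sup>-\<^sup>m\<close> by a 1-Lipschitz function. The
  approximate multiplication is therefore 2-Lipschitz in each argument, hence \<open>\<surd>8\<close>-Lipschitz for
  the Euclidean norm, which yields \<open>8\<^bsup>(d-1)/2\<^esup>\<close> after \<open>d - 1\<close> multiplications.\<close>

section \<open>Approximate multiplication\<close>

definition tent :: "real \<Rightarrow> real" where
  "tent t = 2 * t - 4 * relu (t - 1/2)"

lemma tent_range: "t \<in> {0..1} \<Longrightarrow> tent t \<in> {0..1}"
  by (auto simp: tent_def relu_def max_def)

lemma tent_funpow_range: "t \<in> {0..1} \<Longrightarrow> (tent ^^ n) t \<in> {0..1}"
  by (induction n) (use tent_range in auto)

lemma tent_lipschitz: "\<bar>tent s - tent t\<bar> \<le> 2 * \<bar>s - t\<bar>"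
  unfolding tent_def relu_def by (smt (verit) field_sum_of_halves)

text \<open>Unrolled, this is the sum of the \<open>j\<close>-th tent iterates of \<open>t\<close>
  divided by 4^j for j = 1, ..., m. Peeling off the first iterate matches
  \<open>tent_functional_equation\<close>, so Lipschitz and error bounds follow by
  induction.\<close>

fun tent_sum :: "nat \<Rightarrow> real \<Rightarrow> real" where
  "tent_sum 0 t = 0"
| "tent_sum (Suc m) t = (tent t + tent_sum m (tent t)) / 4"

text \<open>The layers of the network produce the iterates in increasing order, so each new one has
  to be appended at the end of the sum.\<close>

lemma tent_sum_Suc_last: "tent_sum (Suc m) t = tent_sum m t + (tent ^^ Suc m) t / 4 ^ Suc m"
proof (induction m arbitrary: t)
  case (Suc m)
  show ?case
    by (subst tent_sum.simps(2), subst Suc.IH) (simp add: funpow_swap1 field_simps)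
qed simp

text \<open>The factor 2 of the tent map occurs twice and is cancelled by the division by 4, so the
  constant does not grow with \<open>m\<close>.\<close>

lemma tent_sum_lipschitz: "\<bar>tent_sum m s - tent_sum m t\<bar> \<le> \<bar>s - t\<bar>"
proof (induction m arbitrary: s t)
  case (Suc m)
  show ?case
    using Suc[of "tent s" "tent t"] tent_lipschitz[of s t] by (simp add: field_simps)
qed simp

lemma tent_functional_equation: "t * (1 - t) = (tent t + tent t * (1 - tent t)) / 4"
  by (cases "t \<le> 1/2") (auto simp: tent_def relu_def max_def field_simps)

lemma tent_sum_nonneg: "t \<in> {0..1} \<Longrightarrow> 0 \<le> tent_sum m t"
proof (induction m arbitrary: t)
  case (Suc m)
  then show ?case using tent_range[of t] by fastforce
qed simp

text \<open>The functional equation divides the error by 4 in each step, starting from 0 \<le> t (1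
  - t) \<le> 1/4. The one-sided form is what later keeps the error of a difference from
  doubling.\<close>

lemma tent_sum_approx:
  "t \<in> {0..1} \<Longrightarrow> t * (1 - t) - tent_sum m t \<in> {0..(1/4) ^ Suc m}"
proof (induction m arbitrary: t)
  case 0
  have "0 \<le> (2 * t - 1)\<^sup>2" by simp
  moreover have "t * t \<le> t * 1" using 0 by (intro mult_left_mono) auto
  ultimately show ?case by (auto simp: power2_eq_square algebra_simps)
next
  case (Suc m)
  have "t * (1 - t) - tent_sum (Suc m) t = (tent t * (1 - tent t) - tent_sum m (tent t)) / 4"
    by (subst tent_functional_equation) (simp add: diff_divide_distrib add_divide_distrib)
  with Suc.IH[OF tent_range[OF Suc.prems]] show ?case
    unfolding power_Suc atLeastAtMost_iff by argo
qed

section \<open>Approximate products of two and of several factors\<close>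

text \<open>A polarization identity; the shift by 2 and the division by 4 put both arguments into
  [0,1] when \<open>p\<close> and \<open>x\<close> lie in [-1,1].\<close>

definition approx_mult :: "nat \<Rightarrow> real \<Rightarrow> real \<Rightarrow> real" where
  "approx_mult m p x = 4 * (tent_sum m ((p - x + 2) / 4) - tent_sum m ((p + x + 2) / 4))"

lemma approx_mult_error:
  assumes "\<bar>p\<bar> \<le> 1" "\<bar>x\<bar> \<le> 1"
  shows "\<bar>approx_mult m p x - p * x\<bar> \<le> (1/4) ^ m"
proof -
  define s t where "s = (p - x + 2) / 4" and "t = (p + x + 2) / 4"
  have "s \<in> {0..1}" "t \<in> {0..1}" using assms by (auto simp: s_def t_def)
  from this[THEN tent_sum_approx[where m = m]]
  \<comment> \<open>Both errors lie in the same interval starting at 0, so their difference is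
    bounded by its length.\<close>
  have "\<bar>(s * (1 - s) - tent_sum m s) - (t * (1 - t) - tent_sum m t)\<bar> \<le> (1/4) ^ Suc m"
    unfolding atLeastAtMost_iff by linarith
  moreover have "p * x = 4 * (s * (1 - s) - t * (1 - t))"
    by (simp add: s_def t_def field_simps)
  ultimately show ?thesis
    unfolding approx_mult_def s_def[symmetric] t_def[symmetric] power_Suc by argo
qed

text \<open>Both values of \<open>tent_sum\<close> lie in [0,1/4]. Hence intermediate products stay
  in [-1,1] without further clipping, and adding 1 makes them nonnegative.\<close>

lemma approx_mult_bound:
  assumes "\<bar>p\<bar> \<le> 1" "\<bar>x\<bar> \<le> 1"
  shows "\<bar>approx_mult m p x\<bar> \<le> 1"
proof -
  have quarter: "tent_sum m t \<in> {0..1/4}" if "t \<in> {0..1}" for t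
  proof -
    have "0 \<le> (2 * t - 1)\<^sup>2" by simp
    then show ?thesis
      using tent_sum_approx[OF that, of m] tent_sum_nonneg[OF that, of m]
      by (auto simp: power2_eq_square algebra_simps)
  qed
  have "(p - x + 2) / 4 \<in> {0..1}" "(p + x + 2) / 4 \<in> {0..1}" using assms by auto
  from this[THEN quarter] show ?thesis by (auto simp: approx_mult_def abs_le_iff)
qed

lemma approx_mult_lipschitz:
  "\<bar>approx_mult m p x - approx_mult m q y\<bar> \<le> 2 * \<bar>p - q\<bar> + 2 * \<bar>x - y\<bar>"
proof -
  have "\<bar>(p - x + 2) / 4 - (q - y + 2) / 4\<bar> \<le> (\<bar>p - q\<bar> + \<bar>x - y\<bar>) / 4"
    "\<bar>(p + x + 2) / 4 - (q + y + 2) / 4\<bar> \<le> (\<bar>p - q\<bar> + \<bar>x - y\<bar>) / 4"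
    by argo+
  with tent_sum_lipschitz[of m "(p - x + 2) / 4" "(q - y + 2) / 4"]
    tent_sum_lipschitz[of m "(p + x + 2) / 4" "(q + y + 2) / 4"]
  show ?thesis unfolding approx_mult_def by argo
qed

text \<open>Beware of the index shift: \<open>approx_prod m z k\<close> has \<open>k + 1\<close> factors.\<close>

fun approx_prod :: "nat \<Rightarrow> (nat \<Rightarrow> real) \<Rightarrow> nat \<Rightarrow> real" where
  "approx_prod m z 0 = z 0"
| "approx_prod m z (Suc k) = approx_mult m (approx_prod m z k) (z (Suc k))"

lemma approx_prod_bound:
  assumes "\<And>i. \<bar>z i\<bar> \<le> 1"
  shows "\<bar>approx_prod m z k\<bar> \<le> 1"
  by (induction k) (simp_all add: assms approx_mult_bound)

text \<open>Since the factors are at most 1 in absolute value, earlier errors are passed on without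
  growth, and each multiplication adds at most 4^(-m).\<close>

lemma approx_prod_error:
  assumes z: "\<And>i. \<bar>z i\<bar> \<le> 1"
  shows "\<bar>approx_prod m z k - (\<Prod>i<Suc k. z i)\<bar> \<le> real k * (1/4) ^ m"
proof (induction k)
  case (Suc k)
  let ?p = "approx_prod m z k" and ?q = "\<Prod>i<Suc k. z i"
  have "\<bar>approx_mult m ?p (z (Suc k)) - ?p * z (Suc k)\<bar> \<le> (1/4) ^ m"
    by (intro approx_mult_error approx_prod_bound z)
  moreover have "\<bar>?p * z (Suc k) - ?q * z (Suc k)\<bar> \<le> real k * (1/4) ^ m"
  proof -
    have "\<bar>?p - ?q\<bar> * \<bar>z (Suc k)\<bar> \<le> \<bar>?p - ?q\<bar> * 1" by (intro mult_left_mono z) simp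
    with Suc show ?thesis by (simp add: left_diff_distrib[symmetric] abs_mult del: prod.lessThan_Suc)
  qed
  moreover have "(\<Prod>i<Suc (Suc k). z i) = ?q * z (Suc k)" by simp
  moreover have "real (Suc k) * (1/4) ^ m = real k * (1/4) ^ m + (1/4::real) ^ m"
    by (simp add: algebra_simps)
  ultimately show ?case by (simp del: prod.lessThan_Suc)
qed simp

text \<open>Squaring fits the Euclidean norm: (2a + 2b)^2 \<le> 8 (a^2 + b^2), so every
  multiplication costs a factor 8; the new term b^2 is first enlarged by 8^k.\<close>

lemma approx_prod_lipschitz:
  "(approx_prod m z k - approx_prod m w k)\<^sup>2 \<le> 8 ^ k * (\<Sum>i<Suc k. (z i - w i)\<^sup>2)"
proof (induction k)
  case (Suc k)
  define a where "a = \<bar>approx_prod m z k - approx_prod m w k\<bar>"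
  define b where "b = \<bar>z (Suc k) - w (Suc k)\<bar>"
  have "\<bar>approx_prod m z (Suc k) - approx_prod m w (Suc k)\<bar> \<le> 2 * a + 2 * b"
    using approx_mult_lipschitz by (simp add: a_def b_def)
  then have "\<bar>approx_prod m z (Suc k) - approx_prod m w (Suc k)\<bar>\<^sup>2 \<le> (2 * a + 2 * b)\<^sup>2"
    by (intro power_mono) auto
  then have "(approx_prod m z (Suc k) - approx_prod m w (Suc k))\<^sup>2 \<le> (2 * a + 2 * b)\<^sup>2"
    by (simp only: power2_abs)
  also have "\<dots> \<le> 8 * (a\<^sup>2 + b\<^sup>2)"
    using zero_le_power2[of "a - b"] by (simp add: power2_eq_square algebra_simps)
  also have "a\<^sup>2 + b\<^sup>2 \<le> 8 ^ k * (\<Sum>i<Suc k. (z i - w i)\<^sup>2) + 8 ^ k * b\<^sup>2"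
  proof (rule add_mono)
    show "b\<^sup>2 \<le> 8 ^ k * b\<^sup>2" by (rule mult_le_cancel_right1[THEN iffD2]) auto
  qed (use Suc in \<open>simp add: a_def\<close>)
  finally show ?case by (simp add: b_def algebra_simps)
qed simp

section \<open>Clipping, rescaling and the approximation on the whole space\<close>

text \<open>Clipping keeps every factor in [-1,1] for arbitrary inputs, so the network can be
  evaluated on the whole space; on the rescaled cube it changes nothing.\<close>

definition clip :: "real \<Rightarrow> real" where
  "clip t = relu (t + 1) - relu (t - 1) - 1"

lemma clip_range: "\<bar>clip t\<bar> \<le> 1"
  unfolding clip_def relu_def by linarith

lemma clip_id: "\<bar>t\<bar> \<le> 1 \<Longrightarrow> clip t = t"
  unfolding clip_def relu_def by linarith

lemma clip_lipschitz: "\<bar>clip s - clip t\<bar> \<le> \<bar>s - t\<bar>"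
  unfolding clip_def relu_def by linarith

definition approx_product_fun :: "nat \<Rightarrow> real \<Rightarrow> nat \<Rightarrow> real vec \<Rightarrow> real" where
  "approx_product_fun m r d x = r ^ d * approx_prod m (\<lambda>i. clip (x $ i / r)) (d - 1)"

lemma approx_product_fun_error:
  assumes "0 < r" "1 \<le> d" "x \<in> cube d r"
  shows "\<bar>product_fun d x - approx_product_fun m r d x\<bar> \<le> r ^ d * (real d * (1/4) ^ m)"
proof -
  let ?z = "\<lambda>i. clip (x $ i / r)"
  from \<open>1 \<le> d\<close> have d: "Suc (d - 1) = d" by simp
  have "\<bar>x $ i / r\<bar> \<le> 1" if "i < d" for i
    using assms that by (auto simp: cube_def abs_le_iff divide_simps)
  then have "(\<Prod>i<d. ?z i) = (\<Prod>i<d. x $ i / r)"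
    by (intro prod.cong refl clip_id) auto
  also have "\<dots> = product_fun d x / r ^ d" by (simp add: product_fun_def prod_dividef)
  finally have "product_fun d x = r ^ d * (\<Prod>i<d. ?z i)" using assms by simp
  then have "\<bar>product_fun d x - approx_product_fun m r d x\<bar>
      = r ^ d * \<bar>approx_prod m ?z (d - 1) - (\<Prod>i<d. ?z i)\<bar>"
    using assms by (simp add: approx_product_fun_def right_diff_distrib[symmetric] abs_mult
        abs_minus_commute)
  also have "\<dots> \<le> r ^ d * (real (d - 1) * (1/4) ^ m)"
    using approx_prod_error[of ?z m "d - 1"] assms
    unfolding d by (intro mult_left_mono) (auto simp: clip_range)
  also have "\<dots> \<le> r ^ d * (real d * (1/4) ^ m)"
    using assms by (intro mult_left_mono mult_right_mono) auto
  finally show ?thesis .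
qed

text \<open>The outer factor r^d and the inner rescaling by 1/r leave r^(d-1).\<close>

lemma approx_product_fun_lipschitz:
  assumes r: "1 \<le> r" and d: "1 \<le> d" and xy: "x \<in> carrier_vec d" "y \<in> carrier_vec d"
  shows "\<bar>approx_product_fun m r d x - approx_product_fun m r d y\<bar>
    \<le> 8 powr ((real d - 1) / 2) * r ^ (d - 1) * euclid_norm (x - y)"
proof -
  let ?z = "\<lambda>i. clip (x $ i / r)" and ?w = "\<lambda>i. clip (y $ i / r)"
  let ?S = "\<Sum>i<d. (x $ i - y $ i)\<^sup>2"
  have d1: "Suc (d - 1) = d" using d by simp
  have "(approx_prod m ?z (d - 1) - approx_prod m ?w (d - 1))\<^sup>2
      \<le> 8 ^ (d - 1) * (\<Sum>i<d. (?z i - ?w i)\<^sup>2)"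
    using approx_prod_lipschitz[of m ?z "d - 1" ?w] unfolding d1 .
  also have "\<dots> \<le> 8 ^ (d - 1) * (\<Sum>i<d. (x $ i / r - y $ i / r)\<^sup>2)"
    by (intro mult_left_mono sum_mono clip_lipschitz[THEN abs_le_square_iff[THEN iffD1]]) auto
  also have "(\<Sum>i<d. (x $ i / r - y $ i / r)\<^sup>2) = ?S / r\<^sup>2"
    by (simp add: diff_divide_distrib[symmetric] power_divide sum_divide_distrib)
  finally have "\<bar>approx_prod m ?z (d - 1) - approx_prod m ?w (d - 1)\<bar>
      \<le> sqrt (8 ^ (d - 1) * (?S / r\<^sup>2))"
    using real_sqrt_le_mono by fastforce
  also have "\<dots> = sqrt (8 ^ (d - 1)) * (sqrt ?S / r)"
    using r by (simp add: real_sqrt_mult real_sqrt_divide)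
  also have "sqrt (8 ^ (d - 1)) = 8 powr ((real d - 1) / 2)"
    using d by (simp add: powr_half_sqrt[symmetric] powr_realpow[symmetric] powr_powr of_nat_diff)
  also have "sqrt ?S = euclid_norm (x - y)"
    using xy by (auto simp: euclid_norm_def L2_set_def)
  finally have "r ^ d * \<bar>approx_prod m ?z (d - 1) - approx_prod m ?w (d - 1)\<bar>
      \<le> r ^ d * (8 powr ((real d - 1) / 2) * (euclid_norm (x - y) / r))"
    using r by (intro mult_left_mono) auto
  moreover have "r ^ d = r ^ (d - 1) * r" by (metis d1 power_Suc2)
  ultimately show ?thesis
    using r by (simp add: approx_product_fun_def right_diff_distrib[symmetric] abs_mult mult_ac)
qed

section \<open>The network\<close>

text \<open>Row \<open>i\<close> is encoded by the pairs (coefficient, column) in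
  \<open>conn i\<close>, so that applying a layer becomes a short explicit sum.\<close>

definition sparse_layer ::
  "nat \<Rightarrow> nat \<Rightarrow> (nat \<Rightarrow> (real \<times> nat) list) \<Rightarrow> (nat \<Rightarrow> real) \<Rightarrow> real mat \<times> real vec" where
  "sparse_layer m n conn bias =
     (mat m n (\<lambda>(i, j). \<Sum>(c, k)\<leftarrow>conn i. if k = j then c else 0), vec m bias)"

lemma sparse_layer_carrier [simp]:
  "fst (sparse_layer m n conn bias) \<in> carrier_mat m n"
  "snd (sparse_layer m n conn bias) \<in> carrier_vec m"
  by (simp_all add: sparse_layer_def)

lemma sparse_row_sum:
  fixes n :: nat
  assumes "\<forall>(c, k)\<in>set cs. k < n"
  shows "(\<Sum>j<n. (\<Sum>(c, k)\<leftarrow>cs. if k = j then c else 0) * f j) = (\<Sum>(c, k)\<leftarrow>cs. c * f k :: real)"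
  using assms
proof (induction cs)
  case (Cons a cs)
  obtain c k where a: "a = (c, k)" by (cases a)
  have "(\<Sum>j<n. (if k = j then c else 0) * f j) = (\<Sum>j<n. if k = j then c * f j else 0)"
    by (intro sum.cong) auto
  also have "\<dots> = c * f k" using Cons.prems a by simp
  finally show ?case using Cons by (simp add: a distrib_right sum.distrib)
qed simp

lemma sparse_layer_affine:
  assumes "dim_vec x = n" "\<And>i. i < m \<Longrightarrow> \<forall>(c, k)\<in>set (conn i). k < n"
  shows "affine (fst (sparse_layer m n conn bias)) (snd (sparse_layer m n conn bias)) x
    = vec m (\<lambda>i. (\<Sum>(c, k)\<leftarrow>conn i. c * x $ k) + bias i)"
  using assms sparse_row_sum[where n = n and f = "vec_index x"]
  by (intro eq_vecI) (auto simp: affine_def sparse_layer_def scalar_prod_def atLeast0LessThan)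

definition apply_layer :: "real mat \<times> real vec \<Rightarrow> real vec \<Rightarrow> real vec" where
  "apply_layer L x = map_vec relu (affine (fst L) (snd L) x)"

text \<open>Only the last layer lacks ReLU. Splitting it off turns the hidden layers into a
  \<open>fold\<close>, which is compatible with appending blocks.\<close>

lemma relu_realization_snoc:
  "relu_realization (\<phi> @ [L]) x = affine (fst L) (snd L) (fold apply_layer \<phi> x)"
proof (induction \<phi> arbitrary: x)
  case Nil
  then show ?case by (cases L) simp
next
  case (Cons K \<phi>)
  then show ?case by (cases K; cases \<phi>; cases L) (simp_all add: apply_layer_def)
qed

lemma sparse_layer_apply:
  assumes "dim_vec x = n" "\<And>i. i < m \<Longrightarrow> \<forall>(c, k)\<in>set (conn i). k < n"
  shows "apply_layer (sparse_layer m n conn bias) x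
    = vec m (\<lambda>i. relu ((\<Sum>(c, k)\<leftarrow>conn i. c * x $ k) + bias i))"
proof -
  have "affine (fst (sparse_layer m n conn bias)) (snd (sparse_layer m n conn bias)) x
    = vec m (\<lambda>i. (\<Sum>(c, k)\<leftarrow>conn i. c * x $ k) + bias i)"
    using assms by (rule sparse_layer_affine)
  then show ?thesis unfolding apply_layer_def by auto
qed

text \<open>The entries \<open>y i\<close> are the clipped inputs, and \<open>q\<close> is the running product, all shifted by 1 so
  that they are nonnegative and ReLU acts on them as the identity.\<close>

definition state :: "nat \<Rightarrow> (nat \<Rightarrow> real) \<Rightarrow> real \<Rightarrow> real \<Rightarrow> real \<Rightarrow> real \<Rightarrow> real \<Rightarrow> real vec" where
  "state d y q a b a' b' = vec (d + 5) (\<lambda>i. if i < d then y i else [q, a, b, a', b'] ! (i - d))"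

definition state_layer ::
  "nat \<Rightarrow> (real \<times> nat) list list \<Rightarrow> real list \<Rightarrow> real mat \<times> real vec" where
  "state_layer d conns bias = sparse_layer (d + 5) (d + 5)
     (\<lambda>i. if i < d then [(1, i)] else conns ! (i - d)) (\<lambda>i. if i < d then 0 else bias ! (i - d))"

lemma less_add5_cases:
  fixes i d :: nat
  assumes "i < d + 5"
  obtains "i < d" | "i = d" | "i = d + 1" | "i = d + 2" | "i = d + 3" | "i = d + 4"
  using assms by linarith

lemma state_index [simp]:
  "i < d \<Longrightarrow> state d y q a b a' b' $ i = y i"
  "state d y q a b a' b' $ d = q"
  "state d y q a b a' b' $ Suc d = a"
  "state d y q a b a' b' $ (d + 2) = b"
  "state d y q a b a' b' $ Suc (Suc d) = b"
  "state d y q a b a' b' $ (d + 3) = a'"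
  "state d y q a b a' b' $ (d + 4) = b'"
  "dim_vec (state d y q a b a' b') = d + 5"
  by (simp_all add: state_def)

section \<open>One multiplication as a block of layers\<close>

text \<open>Entries \<open>d\<close> and \<open>k\<close> hold 1 + p and 1 + x. Their shifts already
  give (p + x + 2) / 4 with bias 0, while (p - x + 2) / 4 needs bias 1/2; the remaining two rows
  subtract 1/2 from these. The product slot restarts at 1, that is, at product 0.\<close>

definition mult_init :: "nat \<Rightarrow> nat \<Rightarrow> real mat \<times> real vec" where
  "mult_init d k = state_layer d
     [[], [(1/4, d), (1/4, k)], [(1/4, d), (1/4, k)], [(1/4, d), (-1/4, k)], [(1/4, d), (-1/4, k)]]
     [1, 0, -1/2, 1/2, 0]"

text \<open>With \<open>a = t\<close> and \<open>b = relu (t - 1/2)\<close>, the next tent iterate is \<open>2 a - 4 b\<close>. It enters the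
  running product with weight \<open>4 / 4\<^bsup>j+1\<^esup>\<close>, the coefficient of that iterate in \<open>approx_mult\<close>.\<close>

definition mult_step :: "nat \<Rightarrow> nat \<Rightarrow> real mat \<times> real vec" where
  "mult_step d j = state_layer d
     [[(1, d), (2 / 4 ^ j, d + 3), (- 4 / 4 ^ j, d + 4), (- 2 / 4 ^ j, d + 1), (4 / 4 ^ j, d + 2)],
      [(2, d + 1), (-4, d + 2)], [(2, d + 1), (-4, d + 2)],
      [(2, d + 3), (-4, d + 4)], [(2, d + 3), (-4, d + 4)]]
     [0, 0, -1/2, 0, -1/2]"

text \<open>The invariant after \<open>mult_init\<close> and \<open>j\<close> steps. The values
  \<open>relu (t - 1/2)\<close> are stored because the tent map is affine in \<open>t\<close> and
  this value.\<close>

definition mult_state :: "nat \<Rightarrow> (nat \<Rightarrow> real) \<Rightarrow> nat \<Rightarrow> real \<Rightarrow> real \<Rightarrow> real vec" where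
  "mult_state d y j p x =
     (let t = (tent ^^ j) ((p + x + 2) / 4); t' = (tent ^^ j) ((p - x + 2) / 4)
      in state d y (1 + approx_mult j p x) t (relu (t - 1/2)) t' (relu (t' - 1/2)))"

lemma relu_eqI: "s = t \<Longrightarrow> 0 \<le> t \<Longrightarrow> relu s = t"
  by (simp add: relu_def)

text \<open>Reduces evaluation to the five working neurons: the other \<open>d\<close> entries are
  copied, and being nonnegative they survive ReLU.\<close>

lemma state_layer_apply:
  assumes "\<And>i. i < d \<Longrightarrow> 0 \<le> y i" "length conns = 5"
    "\<And>cs. cs \<in> set conns \<Longrightarrow> \<forall>(c, k)\<in>set cs. k < d + 5"
    "s = state d y q a b a' b'"
  shows "apply_layer (state_layer d conns bias) s =
    (let v = (\<lambda>i. relu ((\<Sum>(c, k)\<leftarrow>conns ! i. c * s $ k) + bias ! i))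
     in state d y (v 0) (v 1) (v 2) (v 3) (v 4))"
proof (rule eq_vecI)
  have apply_eq: "apply_layer (state_layer d conns bias) s
    = vec (d + 5) (\<lambda>i. relu ((\<Sum>(c, k)\<leftarrow>(if i < d then [(1, i)] else conns ! (i - d)). c * s $ k)
        + (if i < d then 0 else bias ! (i - d))))"
    unfolding state_layer_def
  proof (rule sparse_layer_apply)
    fix i assume "i < d + 5"
    then have "conns ! (i - d) \<in> set conns" if "\<not> i < d" using assms(2) that by (intro nth_mem) auto
    with assms(3) show "\<forall>(c, k)\<in>set (if i < d then [(1, i)] else conns ! (i - d)). k < d + 5" 
      by auto
  qed (simp add: assms(4))
  fix i
  assume "i < dim_vec (let v = (\<lambda>i. relu ((\<Sum>(c, k)\<leftarrow>conns ! i. c * s $ k) + bias ! i))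
     in state d y (v 0) (v 1) (v 2) (v 3) (v 4))"
  then have "i < d + 5" by (simp add: Let_def)
  then show "apply_layer (state_layer d conns bias) s $ i =
    (let v = (\<lambda>i. relu ((\<Sum>(c, k)\<leftarrow>conns ! i. c * s $ k) + bias ! i))
     in state d y (v 0) (v 1) (v 2) (v 3) (v 4)) $ i"
    unfolding apply_eq Let_def
    by (cases rule: less_add5_cases) (simp_all add: assms relu_eqI[OF refl])
qed (simp add: apply_layer_def affine_def state_layer_def sparse_layer_def Let_def)

lemma mult_init_apply:
  assumes "k < d" "\<And>i. i < d \<Longrightarrow> 0 \<le> y i" "\<bar>p\<bar> \<le> 1" "\<bar>y k - 1\<bar> \<le> 1"
  shows "apply_layer (mult_init d k) (state d y (1 + p) a b a' b') = mult_state d y 0 p (y k - 1)"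
proof -
  define s t where "s = (p + (y k - 1) + 2) / 4" and "t = (p - (y k - 1) + 2) / 4"
  have "- 1 \<le> p" "p \<le> 1" "0 \<le> y k" "y k \<le> 2" using assms by auto
  then have "relu ((1 + p) / 4 + y k / 4) = s" "relu ((1 + p) / 4 - y k / 4 + 1/2) = t"
    by (auto simp: s_def t_def relu_def max_def field_simps)
  moreover have "relu ((1 + p) / 4 + y k / 4 - 1/2) = relu (s - 1/2)"
    "relu ((1 + p) / 4 - y k / 4) = relu (t - 1/2)"
    by (rule arg_cong[of _ _ relu], simp add: s_def t_def field_simps)+
  moreover have "mult_state d y 0 p (y k - 1)
      = state d y 1 s (relu (s - 1/2)) t (relu (t - 1/2))"
    by (simp add: mult_state_def Let_def s_def t_def approx_mult_def)
  ultimately show ?thesis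
    unfolding mult_init_def using assms
    by (subst state_layer_apply[where y = y]) (auto simp: Let_def relu_def[of 1])
qed

lemma mult_step_apply:
  assumes "\<And>i. i < d \<Longrightarrow> 0 \<le> y i" "\<bar>p\<bar> \<le> 1" "\<bar>x\<bar> \<le> 1"
  shows "apply_layer (mult_step d j) (mult_state d y j p x) = mult_state d y (Suc j) p x"
proof -
  define s t where "s = (p + x + 2) / 4" and "t = (p - x + 2) / 4"
  have "s \<in> {0..1}" "t \<in> {0..1}" using assms by (auto simp: s_def t_def)
  then have nonneg: "0 \<le> (tent ^^ Suc j) s" "0 \<le> (tent ^^ Suc j) t"
    using tent_funpow_range by (metis atLeastAtMost_iff)+
  define a b a' b' where "a = (tent ^^ j) s" and "b = relu (a - 1/2)"
    and "a' = (tent ^^ j) t" and "b' = relu (a' - 1/2)"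
  have tent_eq: "(tent ^^ Suc j) s = 2 * a - 4 * b" "(tent ^^ Suc j) t = 2 * a' - 4 * b'"
    by (simp_all add: a_def b_def a'_def b'_def tent_def)
  have "approx_mult (Suc j) p x = approx_mult j p x + ((2 * a' - 4 * b') - (2 * a - 4 * b)) / 4 ^ j"
    unfolding approx_mult_def tent_sum_Suc_last s_def[symmetric] t_def[symmetric] tent_eq
    by (simp add: field_simps)
  \<comment> \<open>The bound on the approximate product makes ReLU the identity on the shifted
    slot.\<close>
  moreover have "0 \<le> 1 + approx_mult (Suc j) p x"
    using approx_mult_bound[OF assms(2,3), of "Suc j"] by simp
  ultimately have q: "relu (1 + approx_mult j p x
      + (2 * a' / 4 ^ j + (- (4 * b' / 4 ^ j) + (- (2 * a / 4 ^ j) + 4 * b / 4 ^ j))))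
      = 1 + approx_mult (Suc j) p x"
    by (intro relu_eqI) (simp_all add: diff_divide_distrib add_divide_distrib)
  have "mult_state d y j p x = state d y (1 + approx_mult j p x) a b a' b'"
    by (simp add: mult_state_def Let_def a_def b_def a'_def b'_def s_def t_def)
  then show ?thesis
    unfolding mult_step_def
    using q nonneg
    by (subst state_layer_apply[where y = y])
      (auto simp: assms relu_eqI[OF refl] Let_def mult_state_def s_def[symmetric] t_def[symmetric]
        tent_eq simp del: funpow.simps)
qed

definition mult_block :: "nat \<Rightarrow> nat \<Rightarrow> nat \<Rightarrow> (real mat \<times> real vec) list" where
  "mult_block d m k = mult_init d k # map (mult_step d) [0..<m]"

lemma mult_block_apply:
  assumes "k < d" "\<And>i. i < d \<Longrightarrow> 0 \<le> y i" "\<bar>p\<bar> \<le> 1" "\<bar>y k - 1\<bar> \<le> 1"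
  shows "fold apply_layer (mult_block d m k) (state d y (1 + p) a b a' b')
    = mult_state d y m p (y k - 1)"
proof (induction m)
  case 0
  show ?case using assms mult_init_apply[of k d y p a b a' b'] by (simp add: mult_block_def)
next
  case (Suc m)
  show ?case using Suc mult_step_apply[of d y p "y k - 1" m] assms by (simp add: mult_block_def)
qed

text \<open>The scratch values are quantified existentially: the next \<open>mult_init\<close> does
  not read them.\<close>

lemma mult_blocks_apply:
  assumes "K < d" "\<And>i. \<bar>z i\<bar> \<le> 1"
  shows "\<exists>a b a' b'. fold apply_layer (concat (map (mult_block d m) [1..<Suc K]))
      (state d (\<lambda>i. z i + 1) (z 0 + 1) 0 0 0 0)
    = state d (\<lambda>i. z i + 1) (1 + approx_prod m z K) a b a' b'"
  using assms(1)
proof (induction K)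
  case 0
  show ?case by (auto simp: add.commute)
next
  case (Suc K)
  from Suc obtain a b a' b' where IH:
    "fold apply_layer (concat (map (mult_block d m) [1..<Suc K]))
      (state d (\<lambda>i. z i + 1) (z 0 + 1) 0 0 0 0)
    = state d (\<lambda>i. z i + 1) (1 + approx_prod m z K) a b a' b'" by auto
  have "0 \<le> z i + 1" for i using assms(2)[of i] by linarith
  then show ?case
    using mult_block_apply[of "Suc K" d "\<lambda>i. z i + 1" "approx_prod m z K" m a b a' b'] Suc.prems
      IH assms
    by (auto simp: approx_prod_bound mult_state_def Let_def)
qed

section \<open>Clipping layers and the complete network\<close>

definition clip_layer1 :: "nat \<Rightarrow> real \<Rightarrow> real mat \<times> real vec" where
  "clip_layer1 d r = sparse_layer (2 * d) d
     (\<lambda>i. [(1 / r, if i < d then i else i - d)]) (\<lambda>i. if i < d then 1 else -1)"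

text \<open>The -1 in \<open>clip\<close> cancels against the shift by 1, hence zero bias. Entry
  \<open>d\<close> starts the running product with the first factor.\<close>

definition clip_layer2 :: "nat \<Rightarrow> real mat \<times> real vec" where
  "clip_layer2 d = sparse_layer (d + 5) (2 * d)
     (\<lambda>i. if i < d then [(1, i), (-1, i + d)] else if i = d then [(1, 0), (-1, d)] else []) (\<lambda>_. 0)"

lemma clip_layers_apply:
  assumes "x \<in> carrier_vec d" "1 \<le> d"
  shows "apply_layer (clip_layer2 d) (apply_layer (clip_layer1 d r) x)
    = state d (\<lambda>i. clip (x $ i / r) + 1) (clip (x $ 0 / r) + 1) 0 0 0 0"
proof -
  let ?u = "\<lambda>i. relu (x $ (if i < d then i else i - d) / r + (if i < d then 1 else - 1))"
  have clip_nonneg: "0 \<le> clip t + 1" for t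
    using clip_range[of t] by linarith
  have "apply_layer (clip_layer1 d r) x = vec (2 * d) ?u"
    unfolding clip_layer1_def using assms
    by (subst sparse_layer_apply) auto
  moreover have "apply_layer (clip_layer2 d) (vec (2 * d) ?u)
     = state d (\<lambda>i. clip (x $ i / r) + 1) (clip (x $ 0 / r) + 1) 0 0 0 0" (is "?l = ?r")
  proof (rule eq_vecI)
    have l: "?l = vec (d + 5) (\<lambda>i. relu ((\<Sum>(c, k)\<leftarrow>
        (if i < d then [(1, i), (-1, i + d)] else if i = d then [(1, 0), (-1, d)] else []).
        c * vec (2 * d) ?u $ k) + 0))"
      unfolding clip_layer2_def using assms by (intro sparse_layer_apply) auto
    fix i assume "i < dim_vec ?r"
    then have "i < d + 5" by simp
    then show "?l $ i = ?r $ i"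
      unfolding l using assms clip_nonneg
      by (cases rule: less_add5_cases) (auto intro!: relu_eqI simp: relu_def[of 0] clip_def)
  qed (simp add: apply_layer_def affine_def clip_layer2_def sparse_layer_def)
  ultimately show ?thesis by simp
qed

text \<open>Undoes the shift by 1 and the rescaling at once.\<close>

definition out_layer :: "nat \<Rightarrow> real \<Rightarrow> real mat \<times> real vec" where
  "out_layer d r = sparse_layer 1 (d + 5) (\<lambda>_. [(r ^ d, d)]) (\<lambda>_. - (r ^ d))"

definition product_net :: "nat \<Rightarrow> real \<Rightarrow> nat \<Rightarrow> skeleton" where
  "product_net m r d = [clip_layer1 d r, clip_layer2 d]
     @ concat (map (mult_block d m) [1..<d]) @ [out_layer d r]"

lemma product_net_realization:
  assumes "x \<in> carrier_vec d" "1 \<le> d"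
  shows "relu_realization (product_net m r d) x = vec 1 (\<lambda>_. approx_product_fun m r d x)"
proof -
  let ?z = "\<lambda>i. clip (x $ i / r)"
  from assms have d: "Suc (d - 1) = d" by simp
  obtain a b a' b' where
    "fold apply_layer (concat (map (mult_block d m) [1..<d])) (state d (\<lambda>i. ?z i + 1) (?z 0 + 1) 0 0 0 0)
      = state d (\<lambda>i. ?z i + 1) (1 + approx_prod m ?z (d - 1)) a b a' b'"
    using mult_blocks_apply[of "d - 1" d ?z m] assms clip_range unfolding d by auto
  then have "relu_realization (product_net m r d) x = affine (fst (out_layer d r)) (snd (out_layer d r))
      (state d (\<lambda>i. ?z i + 1) (1 + approx_prod m ?z (d - 1)) a b a' b')"
    unfolding product_net_def append_assoc[symmetric] relu_realization_snoc
    using clip_layers_apply[OF assms] by simp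
  also have "\<dots> = vec 1 (\<lambda>_. approx_product_fun m r d x)"
    unfolding out_layer_def
    by (subst sparse_layer_affine) (auto simp: approx_product_fun_def algebra_simps)
  finally show ?thesis .
qed

lemma mult_block_carrier:
  assumes "L \<in> set (mult_block d m k)"
  shows "fst L \<in> carrier_mat (d + 5) (d + 5)" "snd L \<in> carrier_vec (d + 5)"
  using assms by (auto simp: mult_block_def mult_init_def mult_step_def state_layer_def)

section \<open>Shape and parameter count\<close>

lemma product_net_skeleton:
  assumes "1 \<le> d"
  shows "product_net m r d \<in> skeletons"
proof -
  let ?hid = "concat (map (mult_block d m) [1..<d])"
  define D where "D = length ?hid + 3"
  define l where "l k = (if k = 0 then d else if k = 1 then 2 * d else if k < D then d + 5 else 1)" for k
  have hid: "fst (?hid ! i) \<in> carrier_mat (d + 5) (d + 5) \<and> snd (?hid ! i) \<in> carrier_vec (d + 5)"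
    if "i < length ?hid" for i
  proof -
    from nth_mem[OF that] obtain k where "?hid ! i \<in> set (mult_block d m k)" by auto
    then show ?thesis using mult_block_carrier by blast
  qed
  have "fst (product_net m r d ! (k - 1)) \<in> carrier_mat (l k) (l (k - 1)) \<and>
      snd (product_net m r d ! (k - 1)) \<in> carrier_vec (l k)" if "k \<in> {1..D}" for k
  proof -
    \<comment> \<open>Layers are counted from 1 and two clipping layers come first, so entry
      \<open>i\<close> of \<open>?hid\<close> is layer i + 3.\<close>
    from that have "k = 1 \<or> k = 2 \<or> k = D \<or> k = (k - 3) + 3 \<and> k - 3 < length ?hid"
      unfolding D_def atLeastAtMost_iff by linarith
    then consider "k = 1" | "k = 2" | i where "k = i + 3" "i < length ?hid" | "k = D" by blast
    then show ?thesis
    proof cases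
      case 1
      then show ?thesis by (simp add: product_net_def clip_layer1_def l_def)
    next
      case 2
      then show ?thesis by (simp add: product_net_def clip_layer2_def l_def D_def)
    next
      case 3
      then show ?thesis using hid by (simp add: product_net_def nth_append l_def D_def)
    next
      case 4
      then show ?thesis by (simp add: product_net_def nth_append out_layer_def l_def D_def)
    qed
  qed
  moreover have "length (product_net m r d) = D" by (simp add: product_net_def D_def)
  moreover have "\<forall>k\<le>D. 1 \<le> l k" using assms by (simp add: l_def)
  moreover have "1 \<le> D" by (simp add: D_def)
  ultimately show ?thesis unfolding skeletons_def by blast
qed

lemma product_net_in_dim: "in_dim (product_net m r d) = d"
  by (simp add: in_dim_def product_net_def clip_layer1_def sparse_layer_def)

lemma product_net_out_dim: "out_dim (product_net m r d) = 1"
  by (simp add: out_dim_def product_net_def out_layer_def sparse_layer_def)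

lemma num_params_simps:
  "num_params [] = 0"
  "num_params (L # \<phi>) = dim_row (fst L) * (dim_col (fst L) + 1) + num_params \<phi>"
  "num_params (\<phi> @ \<psi>) = num_params \<phi> + num_params \<psi>"
  by (simp_all add: num_params_def split_beta)

lemma num_params_mult_blocks:
  "num_params (concat (map (mult_block d m) ks)) = length ks * (m + 1) * ((d + 5) * (d + 6))"
proof -
  have "num_params (map (mult_step d) js) = length js * ((d + 5) * (d + 6))" for js
    by (induction js) (simp_all add: num_params_simps mult_step_def state_layer_def sparse_layer_def)
  then have "num_params (mult_block d m k) = (m + 1) * ((d + 5) * (d + 6))" for k
    by (simp add: mult_block_def num_params_simps mult_init_def state_layer_def sparse_layer_def)
  then show ?thesis by (induction ks) (simp_all add: num_params_simps algebra_simps)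
qed

lemma num_params_product_net:
  "num_params (product_net m r d)
    = 2 * d * (d + 1) + (d + 5) * (2 * d + 1) + (d - 1) * (m + 1) * ((d + 5) * (d + 6)) + (d + 6)"
  unfolding product_net_def num_params_simps num_params_mult_blocks
  by (simp add: clip_layer1_def clip_layer2_def out_layer_def sparse_layer_def)

lemma num_params_product_net_le:
  assumes d: "2 \<le> d"
  shows "real (num_params (product_net m r d)) \<le> 22 * real d ^ 3 * (real m + 1)"
proof -
  define x M where "x = real d" and "M = real m + 1"
  have x: "2 \<le> x" and M: "1 \<le> M" using d by (simp_all add: x_def M_def)
  have x2: "2 * x \<le> x ^ 2" using x by (simp add: power2_eq_square)
  have x3: "2 * x ^ 2 \<le> x ^ 3" using x by (simp add: power2_eq_square power3_eq_cube)
  have "real (num_params (product_net m r d))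
      = (4 * x ^ 2 + 14 * x + 11) * 1 + (x ^ 3 + 10 * x ^ 2 + 19 * x - 30) * M"
    unfolding num_params_product_net x_def M_def using d
    by (cases d) (simp_all add: power2_eq_square power3_eq_cube algebra_simps)
  also have "\<dots> \<le> (4 * x ^ 2 + 14 * x + 11) * M + (x ^ 3 + 10 * x ^ 2 + 19 * x - 30) * M"
    using M x by (intro add_right_mono mult_left_mono) auto
  also have "\<dots> = (x ^ 3 + 14 * x ^ 2 + 33 * x - 19) * M" by (simp add: algebra_simps)
  \<comment> \<open>By \<open>x2\<close> and \<open>x3\<close> the cubic is at most (1 + 7 + 33/4)
    x^3, so 22 leaves room.\<close>
  also have "\<dots> \<le> 22 * x ^ 3 * M" using x x2 x3 M by (intro mult_right_mono) linarith+
  finally show ?thesis by (simp add: x_def M_def)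
qed

section \<open>Lipschitz continuity of the realization\<close>

lemma lipschitz_map_continuous:
  assumes "lipschitz_map m L f" "f \<in> carrier_vec m \<rightarrow> carrier_vec n" "0 < L"
  shows "f \<in> continuous_maps m n"
  unfolding continuous_maps_def
proof (intro CollectI conjI ballI allI impI assms(2))
  fix x :: "real vec" and e :: real
  assume x: "x \<in> carrier_vec m" and e: "0 < e"
  show "\<exists>\<delta>>0. \<forall>y\<in>carrier_vec m. euclid_norm (y - x) < \<delta> \<longrightarrow> euclid_norm (f y - f x) < e"
  proof (intro exI[of _ "e / L"] conjI ballI impI)
    fix y :: "real vec" assume y: "y \<in> carrier_vec m" "euclid_norm (y - x) < e / L"
    have "euclid_norm (f y - f x) \<le> L * euclid_norm (y - x)"
      using assms(1) x y by (simp add: lipschitz_map_def)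
    also have "\<dots> < e" using y assms(3) by (simp add: pos_less_divide_eq mult.commute)
    finally show "euclid_norm (f y - f x) < e" .
  qed (use e assms(3) in simp)
qed

lemma product_net_lipschitz:
  assumes "1 \<le> r" "1 \<le> d"
  shows "lipschitz_map d (8 powr ((real d - 1) / 2) * r ^ (d - 1)) (relu_realization (product_net m r d))"
  unfolding lipschitz_map_def using approx_product_fun_lipschitz[OF assms] assms
  by (simp add: product_net_realization euclid_norm_def L2_set_def)

lemma lipschitz_map_mono:
  assumes "lipschitz_map m L f" "L \<le> L'"
  shows "lipschitz_map m L' f"
proof -
  have "L * euclid_norm v \<le> L' * euclid_norm v" for v
    using assms(2) by (intro mult_right_mono) (simp_all add: euclid_norm_def L2_set_nonneg)
  with assms(1) show ?thesis unfolding lipschitz_map_def by (blast intro: order_trans)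
qed

section \<open>Choice of the number of tent steps and final estimates\<close>

theorem proposition33:
  fixes r :: real
  assumes "1 \<le> r"
  shows "\<forall>d::nat. 2 \<le> d \<longrightarrow> (\<forall>\<epsilon>::real. \<epsilon> \<in> {0<..min (1/2) (inverse r)} \<longrightarrow>
    (\<exists>\<phi>\<in>skeletons. in_dim \<phi> = d \<and> out_dim \<phi> = 1 \<and>
       relu_realization \<phi> \<in> continuous_maps d 1 \<and>
       (SUP x\<in>cube d r. ereal \<bar>product_fun d x - vec_index (relu_realization \<phi> x) 0\<bar>) \<le> ereal \<epsilon> \<and>
       lipschitz_map d (8 powr ((real d - 1) / 2) * r ^ (d * (d - 1))) (relu_realization \<phi>) \<and>
       (r = 1 \<longrightarrow> real (num_params \<phi>)
          \<le> 1/3 * 10 ^ 5 * log 2 (real d) * real d ^ 6 * log 2 (inverse \<epsilon>)) \<and>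
       (2 \<le> r \<longrightarrow> real (num_params \<phi>)
          \<le> 2/5 * 10 ^ 5 * log 2 r * log 2 (real d) * real d ^ 8 * log 2 (inverse \<epsilon>))))"
proof (intro allI impI)
  fix d :: nat and \<epsilon> :: real
  assume d: "2 \<le> d" and \<epsilon>: "\<epsilon> \<in> {0<..min (1/2) (inverse r)}"
  define A B C where "A = log 2 (real d)" and "B = log 2 r" and "C = log 2 (inverse \<epsilon>)"
  have A: "1 \<le> A" using d by (simp add: A_def)
  have B: "0 \<le> B" using assms by (simp add: B_def)
  have C: "1 \<le> C"
    using \<epsilon> by (auto simp: C_def field_simps)
  \<comment> \<open>\<open>X\<close> is the binary logarithm of r^d d / \<epsilon>, so m \<ge> X
    gives 4^m \<ge> 2^m \<ge> r^d d / \<epsilon>, which is the required accuracy.\<close>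
  define X where "X = A + real d * B + C"
  define m where "m = nat \<lceil>X\<rceil>"
  have "0 \<le> X" using A B C by (simp add: X_def)
  then have m: "X \<le> real m" "real m \<le> X + 1" unfolding m_def by linarith+
  let ?\<phi> = "product_net m r d"
  let ?L = "8 powr ((real d - 1) / 2) * r ^ (d * (d - 1))"
  have small: "r ^ d * (real d * (1/4) ^ m) \<le> \<epsilon>"
  proof -
    have "2 powr A = real d" "2 powr B = r" "2 powr C = inverse \<epsilon>"
      using assms d \<epsilon> by (simp_all add: A_def B_def C_def)
    moreover have "2 powr (real d * B) = (2 powr B) ^ d"
      by (simp add: powr_realpow[symmetric] powr_powr mult.commute)
    ultimately have "r ^ d * real d / \<epsilon> = 2 powr X"
      by (simp add: X_def powr_add divide_inverse)
    also have "\<dots> \<le> 2 powr (real m)" using m by (intro powr_mono) auto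
    also have "\<dots> = 2 ^ m" by (simp add: powr_realpow)
    also have "\<dots> \<le> 4 ^ m" by (intro power_mono) auto
    finally show ?thesis using \<epsilon> by (simp add: field_simps)
  qed
  \<comment> \<open>As r \<ge> 1, the exponent d - 1 may be raised to d (d - 1).\<close>
  have lip: "lipschitz_map d ?L (relu_realization ?\<phi>)"
    using assms d
    by (intro lipschitz_map_mono[OF product_net_lipschitz] mult_left_mono power_increasing) auto
  have cont: "relu_realization ?\<phi> \<in> continuous_maps d 1"
    using d assms by (intro lipschitz_map_continuous[OF lip]) (auto simp: product_net_realization)
  have err: "(SUP x\<in>cube d r. ereal \<bar>product_fun d x - vec_index (relu_realization ?\<phi> x) 0\<bar>) \<le> ereal \<epsilon>"
  proof (rule SUP_least)
    fix x assume x: "x \<in> cube d r"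
    then have "vec_index (relu_realization ?\<phi> x) 0 = approx_product_fun m r d x"
      using d by (simp add: product_net_realization cube_def)
    then show "ereal \<bar>product_fun d x - vec_index (relu_realization ?\<phi> x) 0\<bar> \<le> ereal \<epsilon>"
      using approx_product_fun_error[of r d x m] assms d x small by simp
  qed
  have P: "real (num_params ?\<phi>) \<le> 22 * real d ^ 3 * (X + 2)"
  proof -
    have "22 * real d ^ 3 * (real m + 1) \<le> 22 * real d ^ 3 * (X + 2)"
      using m by (intro mult_left_mono) auto
    with num_params_product_net_le[OF d, of m r] show ?thesis by linarith
  qed
  have AC: "1 \<le> A * C" using mult_mono[OF A C] A by simp
  \<comment> \<open>From (A - 1) (C - 1) \<ge> 0; it trades the sum of logarithms in
    \<open>X\<close> for the product in the claim.\<close>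
  have sum_le: "A + C \<le> A * C + 1"
    using mult_nonneg_nonneg[of "A - 1" "C - 1"] A C by (simp add: algebra_simps)
  have P1: "real (num_params ?\<phi>) \<le> 1/3 * 10 ^ 5 * A * real d ^ 6 * C" if "r = 1"
  proof -
    \<comment> \<open>Here B = 0, so X + 2 \<le> A C + 3 \<le> 4 A C.\<close>
    have "22 * real d ^ 3 * (X + 2) \<le> 22 * real d ^ 3 * (4 * (A * C))"
      using that sum_le AC by (intro mult_left_mono) (auto simp: X_def B_def)
    also have "\<dots> \<le> 22 * real d ^ 6 * (4 * (A * C))"
      using AC d by (intro mult_right_mono mult_left_mono power_increasing) auto
    also have "\<dots> = 88 * (real d ^ 6 * (A * C))" by simp
    also have "\<dots> \<le> 1/3 * 10 ^ 5 * (real d ^ 6 * (A * C))"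
      using AC by (intro mult_right_mono) auto
    finally show ?thesis using P by (simp add: mult_ac)
  qed
  have P2: "real (num_params ?\<phi>) \<le> 2/5 * 10 ^ 5 * B * A * real d ^ 8 * C" if "2 \<le> r"
  proof -
    have B1: "1 \<le> B" using that by (simp add: B_def)
    have "X + 2 \<le> real d * B + 4 * (A * C)" using sum_le AC by (simp add: X_def)
    \<comment> \<open>Each summand is multiplied by a quantity at least 1, A C or d B, giving 5 d B
      A C in total.\<close>
    also have "\<dots> \<le> real d * B * (A * C) + 4 * (real d * B) * (A * C)"
    proof (intro add_mono mult_right_mono)
      have "1 * 1 \<le> real d * B" using d B1 by (intro mult_mono) auto
      then show "4 \<le> 4 * (real d * B)" by simp
      show "real d * B \<le> real d * B * (A * C)" using mult_left_mono[OF AC, of "real d * B"] B1 by simp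
    qed (use AC in auto)
    finally have "22 * real d ^ 3 * (X + 2) \<le> 22 * real d ^ 3 * (5 * real d * B * (A * C))"
      by (intro mult_left_mono) (auto simp: mult_ac)
    also have "\<dots> = 110 * (real d ^ 4 * (B * (A * C)))" by (simp add: eval_nat_numeral)
    also have "\<dots> \<le> 110 * (real d ^ 8 * (B * (A * C)))"
      using AC B1 d by (intro mult_left_mono mult_right_mono power_increasing) auto
    also have "\<dots> \<le> 2/5 * 10 ^ 5 * (real d ^ 8 * (B * (A * C)))"
      using AC B1 by (intro mult_right_mono) auto
    finally show ?thesis using P by (simp add: mult_ac)
  qed
  show "\<exists>\<phi>\<in>skeletons. in_dim \<phi> = d \<and> out_dim \<phi> = 1 \<and>
       relu_realization \<phi> \<in> continuous_maps d 1 \<and>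
       (SUP x\<in>cube d r. ereal \<bar>product_fun d x - vec_index (relu_realization \<phi> x) 0\<bar>) \<le> ereal \<epsilon> \<and>
       lipschitz_map d ?L (relu_realization \<phi>) \<and>
       (r = 1 \<longrightarrow> real (num_params \<phi>)
          \<le> 1/3 * 10 ^ 5 * log 2 (real d) * real d ^ 6 * log 2 (inverse \<epsilon>)) \<and>
       (2 \<le> r \<longrightarrow> real (num_params \<phi>)
          \<le> 2/5 * 10 ^ 5 * log 2 r * log 2 (real d) * real d ^ 8 * log 2 (inverse \<epsilon>))"
    using d lip cont err P1 P2 product_net_skeleton[of d m r]
    unfolding A_def B_def C_def
    by (intro bexI[of _ ?\<phi>]) (auto simp: product_net_in_dim product_net_out_dim)
qed

end
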